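(* Let $j,k\ge 2$ be integers and let $\Gamma$ be the class of all $(j,k)$ simple games. Then there exists a unique value $\Psi$ on $\Gamma$ that admits a potential function and distributes the sum of the worths of the minimal critical vectors for all players. This value is given by $$\Psi_i(v)=\sum_{x\in\operatorname{MCV}(v),\,x_i\neq 0} v(x)$$ for all $v\in\Gamma$ and all players $i$ in the player set of $v$, and its potential function is given by $$P(v)=\sum_{x\in\operatorname{MCV}(v)} v(x)$$ for all $v\in\Gamma$.
   Context: Fix integers $j,k\ge 2$ and set $J=\{0,\dots,j-1\}$, $K=\{0,\dots,k-1\}$. A $(j,k)$ simple game with finite player set $N$ (for instance $N=\{1,\dots,n\}$, $n\ge 0$; the empty player set is allowed) is a mapping $v\colon J^N\to K$ with $v(\mathbf{0})=0$ and $v(x)\le v(y)$ for all $x,y\in J^N$ with $x\le y$ (componentwise order); here $\mathbf{0}$ is the all-zero vector. It is not required that $v$ attains the value $k-1$. A vector $x\in J^N$ is called minimal critical for $v$ if $v(x)>0$ and $v(x)>v(x')$ for all $x'\in J^N$ with $x'\le x$ and $x'\ne x$. The set of minimal critical vectors of $v$ is denoted $\operatorname{MCV}(v)$. A value on $\Gamma$ is a function $\Psi$ mapping each $v\in\Gamma$ with player set $N$ to a vector $\Psi(v)=(\Psi_i(v))_{i\in N}\in\mathbb{R}^{N}$. A potential on $\Gamma$ is a function $P\colon\Gamma\to\mathbb{R}$; it is required that $P(v_\emptyset)=0$ for the game $v_\emptyset$ with empty player set. For $v\in\Gamma$ with player set $N$ and $i\in N$, the game $v_{-i}$ is the $(j,k)$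 simple game with player set $N\setminus\{i\}$ defined by $v_{-i}(x)=v(y)$ for $x\in J^{N\setminus\{i\}}$, where $y\in J^N$ has $y_i=0$ and $y_l=x_l$ for all $l\in N\setminus\{i\}$. A value $\Psi$ on $\Gamma$ admits a potential function if there is a potential $P$ on $\Gamma$ such that $\Psi_i(v)=P(v)-P(v_{-i})$ for all $v\in\Gamma$ and all players $i$ of $v$; such a $P$ is then called the potential function of $\Psi$. A value $\Psi$ on $\Gamma$ distributes the sum of the worths of the minimal critical vectors for all players if, for all $v\in\Gamma$ with player set $N$, $$\sum_{i\in N}\Psi_i(v)=\sum_{i\in N}\ \sum_{x\in\operatorname{MCV}(v),\,x_i\ne 0} v(x)=\sum_{x\in\operatorname{MCV}(v)} v(x)\cdot\big|\{i\in N\mid x_i\neq 0\}\big| .$$ *)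

theory Defs
  imports Complex_Main "HOL-Library.FuncSet"
begin

text \<open>
  Players are drawn from an arbitrary type; the players of a game form a finite subset of it.
  The functions involved (vectors, games, solution concepts, potentials) are extensional, so
  that HOL equality is equality of functions on their intended domain.
\<close>

definition profiles :: "nat \<Rightarrow> 'p set \<Rightarrow> ('p \<Rightarrow> nat) set" where
  "profiles j N = (N \<rightarrow>\<^sub>E {..<j})"

definition profile_le :: "'p set \<Rightarrow> ('p \<Rightarrow> nat) \<Rightarrow> ('p \<Rightarrow> nat) \<Rightarrow> bool" where
  "profile_le N x y \<longleftrightarrow> (\<forall>i\<in>N. x i \<le> y i)"

definition zero_profile :: "'p set \<Rightarrow> 'p \<Rightarrow> nat" where
  "zero_profile N = (\<lambda>i\<in>N. 0)"

record 'p game =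
  players :: "'p set"
  worth :: "('p \<Rightarrow> nat) \<Rightarrow> nat"

definition simple_games :: "nat \<Rightarrow> nat \<Rightarrow> 'p game set" where
  "simple_games j k = {v.
     finite (players v) \<and>
     worth v \<in> profiles j (players v) \<rightarrow>\<^sub>E {..<k} \<and>
     worth v (zero_profile (players v)) = 0 \<and>
     (\<forall>x\<in>profiles j (players v). \<forall>y\<in>profiles j (players v).
        profile_le (players v) x y \<longrightarrow> worth v x \<le> worth v y)}"

definition MCV :: "nat \<Rightarrow> 'p game \<Rightarrow> ('p \<Rightarrow> nat) set" where
  "MCV j v = {x \<in> profiles j (players v).
     worth v x > 0 \<and>
     (\<forall>x'\<in>profiles j (players v).
        profile_le (players v) x' x \<and> x' \<noteq> x \<longrightarrow> worth v x > worth v x')}"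

definition remove_player :: "nat \<Rightarrow> 'p \<Rightarrow> 'p game \<Rightarrow> 'p game" where
  "remove_player j i v =
     \<lparr>players = players v - {i},
      worth = (\<lambda>x\<in>profiles j (players v - {i}). worth v (x(i := 0)))\<rparr>"

definition game_values :: "nat \<Rightarrow> nat \<Rightarrow> ('p game \<Rightarrow> 'p \<Rightarrow> real) set" where
  "game_values j k = (\<Pi>\<^sub>E v\<in>simple_games j k. (players v \<rightarrow>\<^sub>E UNIV))"

definition potentials :: "nat \<Rightarrow> nat \<Rightarrow> ('p game \<Rightarrow> real) set" where
  "potentials j k = {P \<in> simple_games j k \<rightarrow>\<^sub>E UNIV.
     \<forall>v\<in>simple_games j k. players v = {} \<longrightarrow> P v = 0}"

definition potential_of ::
    "nat \<Rightarrow> nat \<Rightarrow> ('p game \<Rightarrow> real) \<Rightarrow> ('p game \<Rightarrow> 'p \<Rightarrow> real) \<Rightarrow> bool" where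
  "potential_of j k P \<Psi> \<longleftrightarrow> P \<in> potentials j k \<and>
     (\<forall>v\<in>simple_games j k. \<forall>i\<in>players v. \<Psi> v i = P v - P (remove_player j i v))"

definition admits_potential :: "nat \<Rightarrow> nat \<Rightarrow> ('p game \<Rightarrow> 'p \<Rightarrow> real) \<Rightarrow> bool" where
  "admits_potential j k \<Psi> \<longleftrightarrow> (\<exists>P. potential_of j k P \<Psi>)"

definition distributes_MCV_worths :: "nat \<Rightarrow> nat \<Rightarrow> ('p game \<Rightarrow> 'p \<Rightarrow> real) \<Rightarrow> bool" where
  "distributes_MCV_worths j k \<Psi> \<longleftrightarrow>
     (\<forall>v\<in>simple_games j k.
        (\<Sum>i\<in>players v. \<Psi> v i) =
        (\<Sum>i\<in>players v. \<Sum>x\<in>{x \<in> MCV j v. x i \<noteq> 0}. real (worth v x)))"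

lemma finite_MCV:
  assumes "v \<in> simple_games j k"
  shows "finite (MCV j v)"
proof -
  have "finite (profiles j (players v))"
    using assms by (simp add: simple_games_def profiles_def finite_PiE)
  then show ?thesis
    by (rule rev_finite_subset) (auto simp: MCV_def)
qed

lemma sum_MCV_worths_eq:
  assumes "v \<in> simple_games j k"
  shows "(\<Sum>i\<in>players v. \<Sum>x\<in>{x \<in> MCV j v. x i \<noteq> 0}. real (worth v x)) =
         (\<Sum>x\<in>MCV j v. real (worth v x) * real (card {i \<in> players v. x i \<noteq> 0}))"
proof -
  have fin: "finite (players v)" "finite (MCV j v)"
    using assms finite_MCV by (auto simp: simple_games_def)
  have "(\<Sum>i\<in>players v. \<Sum>x\<in>{x \<in> MCV j v. x i \<noteq> 0}. real (worth v x)) =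
        (\<Sum>x\<in>MCV j v. \<Sum>i\<in>{i \<in> players v. x i \<noteq> 0}. real (worth v x))"
    using fin by (rule sum.swap_restrict)
  then show ?thesis
    by (simp add: mult.commute)
qed

lemma remove_player_in_simple_games:
  assumes v: "v \<in> simple_games j k" and i: "i \<in> players v" and j: "0 < j"
  shows "remove_player j i v \<in> simple_games j k"
proof -
  let ?N = "players v - {i}"
  have upd: "x(i := 0) \<in> profiles j (players v)" if "x \<in> profiles j ?N" for x
    using that i j by (auto simp: profiles_def PiE_iff extensional_def)
  have z: "(zero_profile ?N)(i := 0) = zero_profile (players v)"
    using i by (auto simp: zero_profile_def fun_eq_iff)
  have z': "zero_profile ?N \<in> profiles j ?N"
    using j by (auto simp: zero_profile_def profiles_def)
  have le: "profile_le (players v) (x(i := 0)) (y(i := 0))" if "profile_le ?N x y" for x y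
    using that by (auto simp: profile_le_def)
  show ?thesis
    using v upd z z' le by (auto simp: simple_games_def remove_player_def PiE_iff)
qed

end

(*
  Deleting player i from v removes exactly the minimal critical vectors x with x_i > 0 (the others
  correspond via x |-> x(i := 0)), so P v = (sum of v(x) over MCV(v)) is a potential of the stated
  value.  Conversely, summing the potential equation over all players expresses |N| * P v through
  the prescribed total and the games v_-i, so P is determined by induction on the number of players.
*)
theory Submission
  imports Defs
begin

text \<open>The claimed potential, left unrestricted. Its extensional form, cut down to
  \<open>simple_games j k\<close>, appears only where membership in \<open>potentials\<close>
  matters.\<close>

definition MCV_sum :: "nat \<Rightarrow> 'p game \<Rightarrow> real" where
  "MCV_sum j v = (\<Sum>x\<in>MCV j v. real (worth v x))"

text \<open>The claimed value, likewise total in \<open>v\<close> and \<open>i\<close>.\<close>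

definition MCV_share :: "nat \<Rightarrow> 'p game \<Rightarrow> 'p \<Rightarrow> real" where
  "MCV_share j v i = (\<Sum>x\<in>{x \<in> MCV j v. x i \<noteq> 0}. real (worth v x))"

lemma profile_upd_zero:
  assumes "x \<in> profiles j (N - {i})" "i \<in> N" "0 < j"
  shows "x(i := 0) \<in> profiles j N"
  using assms by (auto simp: profiles_def PiE_iff extensional_def)

text \<open>Vectors are extensional, so dropping coordinate \<open>i\<close> means resetting it to
  \<open>undefined\<close>; this undoes the insertion of a 0 at \<open>i\<close>.\<close>

lemma profile_upd_undefined:
  assumes "x \<in> profiles j N"
  shows "x(i := undefined) \<in> profiles j (N - {i})"
  using assms by (auto simp: profiles_def PiE_iff extensional_def)

lemma profile_removed_undefined:
  assumes "x \<in> profiles j (N - {i})"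
  shows "x i = undefined"
  using assms by (auto simp: profiles_def PiE_iff extensional_def)

text \<open>Every vector below \<open>x(i := 0)\<close> also has entry 0 at \<open>i\<close>, so it
  comes from a vector of the reduced game, where criticality of \<open>x\<close> applies.\<close>

lemma MCV_remove_player_upd:
  assumes x: "x \<in> MCV j (remove_player j i v)" and i: "i \<in> players v" and j: "0 < j"
  shows "x(i := 0) \<in> MCV j v"
proof -
  let ?N = "players v - {i}"
  have xp: "x \<in> profiles j ?N" and pos: "worth v (x(i := 0)) > 0"
    and crit: "\<And>y. y \<in> profiles j ?N \<Longrightarrow> profile_le ?N y x \<Longrightarrow> y \<noteq> x
      \<Longrightarrow> worth v (y(i := 0)) < worth v (x(i := 0))"
    using x by (auto simp: MCV_def remove_player_def)
  have "worth v y < worth v (x(i := 0))"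
    if y: "y \<in> profiles j (players v)" "profile_le (players v) y (x(i := 0))" "y \<noteq> x(i := 0)" for y
  proof -
    have "y i = 0"
      using y(2) i by (auto simp: profile_le_def dest: bspec[of _ _ i])
    then have y0: "y(i := undefined, i := 0) = y"
      by auto
    have "profile_le ?N (y(i := undefined)) x"
      using y(2) by (auto simp: profile_le_def split: if_splits)
    moreover have "y(i := undefined) \<noteq> x"
      using y(3) y0 by auto
    ultimately show ?thesis
      using crit[OF profile_upd_undefined[OF y(1)]] y0 by simp
  qed
  then show ?thesis
    using pos profile_upd_zero[OF xp i j] by (auto simp: MCV_def)
qed

text \<open>A competitor in the reduced game, extended by 0 at \<open>i\<close>, lies below
  \<open>x\<close>, so criticality is inherited. The condition \<open>x i = 0\<close> ensures that
  dropping and reinserting coordinate \<open>i\<close> gives back \<open>x\<close>.\<close>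

lemma MCV_upd_remove_player:
  assumes x: "x \<in> MCV j v" and xi: "x i = 0" and i: "i \<in> players v" and j: "0 < j"
  shows "x(i := undefined) \<in> MCV j (remove_player j i v)"
proof -
  let ?N = "players v - {i}" and ?x = "x(i := undefined)"
  have xp: "x \<in> profiles j (players v)"
    using x by (simp add: MCV_def)
  have x0: "?x(i := 0) = x"
    using xi by auto
  have "worth v (y(i := 0)) < worth v x"
    if y: "y \<in> profiles j ?N" "profile_le ?N y ?x" "y \<noteq> ?x" for y
  proof -
    have "profile_le (players v) (y(i := 0)) x"
      using y(2) by (auto simp: profile_le_def)
    \<comment> \<open>Since \<open>y i\<close> is already \<open>undefined\<close>, equality here
      would force \<open>y = ?x\<close>.\<close>
    moreover have "y(i := 0) \<noteq> x"
      using y(3) profile_removed_undefined[OF y(1)] by auto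
    ultimately show ?thesis
      using x profile_upd_zero[OF y(1) i j] by (auto simp: MCV_def)
  qed
  moreover have "worth v x > 0"
    using x by (simp add: MCV_def)
  ultimately show ?thesis
    using profile_upd_undefined[OF xp, of i] x0 by (auto simp: MCV_def remove_player_def)
qed

lemma bij_betw_MCV_remove_player:
  assumes "i \<in> players v" "0 < j"
  shows "bij_betw (\<lambda>x. x(i := 0)) (MCV j (remove_player j i v)) {x \<in> MCV j v. x i = 0}"
proof (rule bij_betwI[where g = "\<lambda>x. x(i := undefined)"])
  show "(\<lambda>x. x(i := 0)) \<in> MCV j (remove_player j i v) \<rightarrow> {x \<in> MCV j v. x i = 0}"
    using MCV_remove_player_upd[OF _ assms] by auto
  show "(\<lambda>x. x(i := undefined)) \<in> {x \<in> MCV j v. x i = 0} \<rightarrow> MCV j (remove_player j i v)"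
    using MCV_upd_remove_player[OF _ _ assms] by auto
  show "x(i := 0, i := undefined) = x" if "x \<in> MCV j (remove_player j i v)" for x
    using that profile_removed_undefined[of x j "players v" i]
    by (auto simp: MCV_def remove_player_def)
qed auto

text \<open>The bijection preserves worths: the reduced game assigns to \<open>x\<close> the worth
  of \<open>x(i := 0)\<close> in \<open>v\<close>.\<close>

lemma MCV_sum_remove_player:
  assumes "i \<in> players v" "0 < j"
  shows "MCV_sum j (remove_player j i v) = (\<Sum>x\<in>{x \<in> MCV j v. x i = 0}. real (worth v x))"
proof -
  have "MCV_sum j (remove_player j i v) =
      (\<Sum>x\<in>MCV j (remove_player j i v). real (worth v (x(i := 0))))"
    unfolding MCV_sum_def
    by (rule sum.cong[OF refl]) (simp add: MCV_def remove_player_def)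
  then show ?thesis
    using sum.reindex_bij_betw[OF bij_betw_MCV_remove_player[OF assms],
      of "\<lambda>x. real (worth v x)"] by simp
qed

text \<open>Split \<open>MCV j v\<close> according to whether \<open>x i\<close> vanishes; the
  vanishing part is the sum for the reduced game.\<close>

lemma MCV_share_eq_diff:
  assumes v: "v \<in> simple_games j k" and i: "i \<in> players v" and j: "0 < j"
  shows "MCV_share j v i = MCV_sum j v - MCV_sum j (remove_player j i v)"
proof -
  have "MCV_sum j v = (\<Sum>x\<in>{x \<in> MCV j v. x i \<noteq> 0} \<union> {x \<in> MCV j v. x i = 0}. real (worth v x))"
    unfolding MCV_sum_def by (rule sum.cong) auto
  also have "\<dots> = MCV_share j v i + MCV_sum j (remove_player j i v)"
    unfolding MCV_share_def MCV_sum_remove_player[OF i j]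
    using finite_MCV[OF v] by (intro sum.union_disjoint) auto
  finally show ?thesis
    by simp
qed

text \<open>The only vector is then the zero profile, whose worth 0 excludes it from
  \<open>MCV j v\<close>.\<close>

lemma MCV_sum_no_players:
  assumes "v \<in> simple_games j k" "players v = {}"
  shows "MCV_sum j v = 0"
proof -
  have "MCV j v = {}"
    using assms by (auto simp: MCV_def profiles_def simple_games_def zero_profile_def restrict_def)
  then show ?thesis
    by (simp add: MCV_sum_def)
qed

lemma potential_eq_MCV_sum:
  assumes P: "potential_of j k P \<Psi>" and \<Psi>: "distributes_MCV_worths j k \<Psi>"
    and v: "v \<in> simple_games j k" and j: "0 < j"
  shows "P v = MCV_sum j v"
  using v
proof (induction "card (players v)" arbitrary: v rule: less_induct)
  case less
  have fin: "finite (players v)"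
    using less.prems by (simp add: simple_games_def)
  show ?case
  proof (cases "players v = {}")
    case True
    then show ?thesis
      using P less.prems MCV_sum_no_players by (auto simp: potential_of_def potentials_def)
  next
    case False
    have IH: "P (remove_player j i v) = MCV_sum j (remove_player j i v)" if "i \<in> players v" for i
      using card_Diff1_less[OF fin that] remove_player_in_simple_games[OF less.prems that j]
      by (intro less.hyps) (simp_all add: remove_player_def)
    \<comment> \<open>By induction the potentials of all reduced games are known, so
      \<open>P v\<close> is the only unknown in the summed potential equations.\<close>
    have "(\<Sum>i\<in>players v. P v - MCV_sum j (remove_player j i v)) = (\<Sum>i\<in>players v. \<Psi> v i)"
      using P less.prems by (intro sum.cong) (auto simp: potential_of_def IH)
    also have "\<dots> = (\<Sum>i\<in>players v. MCV_share j v i)"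
      using \<Psi> less.prems by (simp add: distributes_MCV_worths_def MCV_share_def)
    also have "\<dots> = (\<Sum>i\<in>players v. MCV_sum j v - MCV_sum j (remove_player j i v))"
      using MCV_share_eq_diff[OF less.prems _ j] by simp
    \<comment> \<open>The reduced-game terms cancel on both sides. The remaining factor is nonzero
      because the player set is finite and nonempty.\<close>
    finally have "real (card (players v)) * P v = real (card (players v)) * MCV_sum j v"
      by (simp add: sum_subtractf)
    then show ?thesis
      using False fin by simp
  qed
qed

text \<open>Only the entries of \<open>\<Psi>\<close> at actual players matter, so this serves both
  the explicit witness and an arbitrary value satisfying the two conditions.\<close>

lemma potential_of_MCV_sum:
  assumes "0 < j"
    and "\<And>v i. v \<in> simple_games j k \<Longrightarrow> i \<in> players v \<Longrightarrow> \<Psi> v i = MCV_share j v i"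
  shows "potential_of j k (\<lambda>v\<in>simple_games j k. MCV_sum j v) \<Psi>"
  using assms(1)
  by (auto simp: potential_of_def potentials_def assms(2) MCV_share_eq_diff
      MCV_sum_no_players remove_player_in_simple_games)

text \<open>Differences of the potential determine the value, so uniqueness of the potential carries
  over to it.\<close>

lemma value_eq_MCV_share:
  assumes "admits_potential j k \<Psi>" "distributes_MCV_worths j k \<Psi>" "0 < j"
    and v: "v \<in> simple_games j k" and i: "i \<in> players v"
  shows "\<Psi> v i = MCV_share j v i"
proof -
  obtain P where P: "potential_of j k P \<Psi>"
    using assms by (auto simp: admits_potential_def)
  then have "\<Psi> v i = P v - P (remove_player j i v)"
    using v i by (simp add: potential_of_def)
  then show ?thesis
    using potential_eq_MCV_sum[OF P assms(2) _ assms(3)] v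
      remove_player_in_simple_games[OF v i assms(3)] MCV_share_eq_diff[OF v i assms(3)] by simp
qed

theorem theorem1:
  fixes j k :: nat
  assumes "j \<ge> 2" and "k \<ge> 2"
  shows "(\<exists>!\<Psi> :: 'p game \<Rightarrow> 'p \<Rightarrow> real.
            \<Psi> \<in> game_values j k \<and> admits_potential j k \<Psi> \<and> distributes_MCV_worths j k \<Psi>) \<and>
         (\<forall>\<Psi> :: 'p game \<Rightarrow> 'p \<Rightarrow> real.
            \<Psi> \<in> game_values j k \<and> admits_potential j k \<Psi> \<and> distributes_MCV_worths j k \<Psi> \<longrightarrow>
              (\<forall>v\<in>simple_games j k. \<forall>i\<in>players v.
                 \<Psi> v i = (\<Sum>x\<in>{x \<in> MCV j v. x i \<noteq> 0}. real (worth v x))) \<and>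
              (\<forall>P. potential_of j k P \<Psi> \<longleftrightarrow>
                 P = (\<lambda>v\<in>simple_games j k. \<Sum>x\<in>MCV j v. real (worth v x))))"
proof -
  have j: "0 < j"
    using assms by simp
  let ?good = "\<lambda>\<Psi> :: 'p game \<Rightarrow> 'p \<Rightarrow> real.
    \<Psi> \<in> game_values j k \<and> admits_potential j k \<Psi> \<and> distributes_MCV_worths j k \<Psi>"
  let ?\<Psi> = "\<lambda>v\<in>simple_games j k. \<lambda>i\<in>players v. MCV_share j (v :: 'p game) i"
  have good: "?good ?\<Psi>"
  proof (intro conjI)
    show "?\<Psi> \<in> game_values j k"
      by (auto simp: game_values_def)
    show "admits_potential j k ?\<Psi>"
      unfolding admits_potential_def by (rule exI, rule potential_of_MCV_sum[OF j]) simp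
    show "distributes_MCV_worths j k ?\<Psi>"
      by (auto simp: distributes_MCV_worths_def MCV_share_def)
  qed
  have share: "\<Psi> v i = MCV_share j v i"
    if "?good \<Psi>" "v \<in> simple_games j k" "i \<in> players v" for \<Psi> :: "'p game \<Rightarrow> 'p \<Rightarrow> real" and v i
    by (rule value_eq_MCV_share[OF _ _ j]) (use that in simp_all)
  \<comment> \<open>Agreement on players of games becomes equality of functions by extensionality at
    two levels: in the player and in the game.\<close>
  have uniq: "\<Psi> = ?\<Psi>" if \<Psi>: "?good \<Psi>" for \<Psi>
  proof -
    have "\<Psi> v = ?\<Psi> v" if v: "v \<in> simple_games j k" for v
    proof (rule PiE_ext)
      show "\<Psi> v \<in> players v \<rightarrow>\<^sub>E UNIV" "?\<Psi> v \<in> players v \<rightarrow>\<^sub>E UNIV"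
        using \<Psi> v by (auto simp: game_values_def)
      show "\<Psi> v i = ?\<Psi> v i" if "i \<in> players v" for i
        using share[OF \<Psi> v that] v that by simp
    qed
    moreover have "\<Psi> \<in> extensional (simple_games j k)"
      using \<Psi> by (simp add: game_values_def PiE_iff)
    ultimately show ?thesis
      by (intro extensionalityI[OF _ restrict_extensional])
  qed
  have pot: "potential_of j k P \<Psi> \<longleftrightarrow> P = (\<lambda>v\<in>simple_games j k. MCV_sum j v)"
    if \<Psi>: "?good \<Psi>" for \<Psi> P
  proof
    assume P: "potential_of j k P \<Psi>"
    then have "P \<in> extensional (simple_games j k)"
      by (auto simp: potential_of_def potentials_def PiE_iff)
    then show "P = (\<lambda>v\<in>simple_games j k. MCV_sum j v)"
      using potential_eq_MCV_sum[OF P _ _ j] \<Psi> by (intro extensionalityI) auto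
  next
    assume "P = (\<lambda>v\<in>simple_games j k. MCV_sum j v)"
    then show "potential_of j k P \<Psi>"
      using potential_of_MCV_sum[OF j share[OF \<Psi>]] by simp
  qed
  have "\<exists>!\<Psi>. ?good \<Psi>"
    using good uniq by (rule ex1I)
  moreover have "\<forall>\<Psi>. ?good \<Psi> \<longrightarrow>
      (\<forall>v\<in>simple_games j k. \<forall>i\<in>players v. \<Psi> v i = MCV_share j v i) \<and>
      (\<forall>P. potential_of j k P \<Psi> \<longleftrightarrow> P = (\<lambda>v\<in>simple_games j k. MCV_sum j v))"
    using share pot by (intro allI impI, intro conjI ballI allI) simp_all
  ultimately show ?thesis
    unfolding MCV_share_def MCV_sum_def by (rule conjI)
qed

end
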